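(* $\textsc{\#MonotoneSat}\in\#\mathsf{\Pi_2\text{-}1VAR}$.
   Context: $\textsc{\#MonotoneSat}$: given a propositional CNF formula in which all literals are positive, output its number of satisfying assignments. Such a formula is encoded as an ordered structure over the vocabulary $\{C\}$, $C$ binary, with $C(c,x)$ iff variable $x$ appears in clause $c$. A counting problem $\#B$ on finite ordered $\sigma$-structures belongs to $\#\mathsf{\Pi_2\text{-}1VAR}$ if there is a formula $\psi(\vec y,\vec z,X)=\phi(\vec y,\vec z)\wedge X(\vec z)$, with $\phi$ a first-order formula over $\sigma$ and $X$ a single second-order variable (occurring positively), such that for every input structure $\mathcal{A}$, $\#B(\mathcal{A})=|\{\langle X\rangle : \mathcal{A}\models\forall\vec y\exists\vec z\,\psi(\vec y,\vec z,X)\}|$. *)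

theory Defs
  imports Main "HOL-Library.FuncSet"
begin

section \<open>Finite ordered structures and formulas with one second-order variable\<close>

text \<open>
  A relational vocabulary is given by a type \<open>'r\<close> of relation symbols and an arity function.
  Every finite ordered structure has an isomorphic copy with universe a finite set of naturals;
  the order \<open>ord\<close> is an arbitrary linear order on the universe, unrelated to the order of \<open>nat\<close>.
\<close>

record 'r fostruct =
  univ :: "nat set"
  ord :: "(nat \<times> nat) set"
  interp :: "'r \<Rightarrow> nat list set"

definition tuples :: "nat set \<Rightarrow> nat \<Rightarrow> nat list set" where
  "tuples A k = {as. length as = k \<and> set as \<subseteq> A}"

text \<open>
  The empty universe is admitted; it is needed only to encode the CNF formula without clauses.
\<close>

definition ordered_structure :: "('r \<Rightarrow> nat) \<Rightarrow> 'r fostruct \<Rightarrow> bool" where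
  "ordered_structure ar \<A> \<longleftrightarrow>
     finite (univ \<A>) \<and> linear_order_on (univ \<A>) (ord \<A>) \<and>
     (\<forall>r. interp \<A> r \<subseteq> tuples (univ \<A>) (ar r))"

text \<open>
  First-order variables are naturals. \<open>SO xs\<close> is the atom \<open>X(xs)\<close> for the only
  second-order variable \<open>X\<close>. Equality and the order are logical symbols.
\<close>

datatype 'r fm =
    Eq nat nat
  | Le nat nat
  | Rel 'r "nat list"
  | SO "nat list"
  | Neg "'r fm"
  | Conj "'r fm" "'r fm"
  | Disj "'r fm" "'r fm"
  | Ex nat "'r fm"
  | All nat "'r fm"

primrec sat :: "'r fostruct \<Rightarrow> nat list set \<Rightarrow> (nat \<Rightarrow> nat) \<Rightarrow> 'r fm \<Rightarrow> bool" where
  "sat \<A> X s (Eq x y) \<longleftrightarrow> s x = s y"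
| "sat \<A> X s (Le x y) \<longleftrightarrow> (s x, s y) \<in> ord \<A>"
| "sat \<A> X s (Rel r xs) \<longleftrightarrow> map s xs \<in> interp \<A> r"
| "sat \<A> X s (SO xs) \<longleftrightarrow> map s xs \<in> X"
| "sat \<A> X s (Neg p) \<longleftrightarrow> \<not> sat \<A> X s p"
| "sat \<A> X s (Conj p q) \<longleftrightarrow> sat \<A> X s p \<and> sat \<A> X s q"
| "sat \<A> X s (Disj p q) \<longleftrightarrow> sat \<A> X s p \<or> sat \<A> X s q"
| "sat \<A> X s (Ex x p) \<longleftrightarrow> (\<exists>a\<in>univ \<A>. sat \<A> X (s(x := a)) p)"
| "sat \<A> X s (All x p) \<longleftrightarrow> (\<forall>a\<in>univ \<A>. sat \<A> X (s(x := a)) p)"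

primrec fv :: "'r fm \<Rightarrow> nat set" where
  "fv (Eq x y) = {x, y}"
| "fv (Le x y) = {x, y}"
| "fv (Rel r xs) = set xs"
| "fv (SO xs) = set xs"
| "fv (Neg p) = fv p"
| "fv (Conj p q) = fv p \<union> fv q"
| "fv (Disj p q) = fv p \<union> fv q"
| "fv (Ex x p) = fv p - {x}"
| "fv (All x p) = fv p - {x}"

primrec first_order :: "('r \<Rightarrow> nat) \<Rightarrow> 'r fm \<Rightarrow> bool" where
  "first_order ar (Eq x y) \<longleftrightarrow> True"
| "first_order ar (Le x y) \<longleftrightarrow> True"
| "first_order ar (Rel r xs) \<longleftrightarrow> length xs = ar r"
| "first_order ar (SO xs) \<longleftrightarrow> False"
| "first_order ar (Neg p) \<longleftrightarrow> first_order ar p"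
| "first_order ar (Conj p q) \<longleftrightarrow> first_order ar p \<and> first_order ar q"
| "first_order ar (Disj p q) \<longleftrightarrow> first_order ar p \<and> first_order ar q"
| "first_order ar (Ex x p) \<longleftrightarrow> first_order ar p"
| "first_order ar (All x p) \<longleftrightarrow> first_order ar p"

text \<open>
  Used for sentences only, whose truth value does not depend on the assignment \<open>s\<close>.
\<close>

definition models :: "'r fostruct \<Rightarrow> nat list set \<Rightarrow> 'r fm \<Rightarrow> bool" where
  "models \<A> X p \<longleftrightarrow> (\<forall>s. sat \<A> X s p)"

definition pi2_1var_sentence :: "nat list \<Rightarrow> nat list \<Rightarrow> 'r fm \<Rightarrow> 'r fm" where
  "pi2_1var_sentence ys zs \<phi> = foldr All ys (foldr Ex zs (Conj \<phi> (SO zs)))"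

text \<open>
  A counting problem on ordered structures is represented by the graph of the counting
  function on its input structures.
\<close>

type_synonym 'r counting_problem = "('r fostruct \<times> nat) set"

definition sharp_Pi2_1VAR :: "('r \<Rightarrow> nat) \<Rightarrow> 'r counting_problem set" where
  "sharp_Pi2_1VAR ar =
     {B. B \<subseteq> {\<A>. ordered_structure ar \<A>} \<times> UNIV \<and>
         (\<exists>\<phi> ys zs.
            first_order ar \<phi> \<and> distinct (ys @ zs) \<and> zs \<noteq> [] \<and> fv \<phi> \<subseteq> set (ys @ zs) \<and>
            (\<forall>(\<A>, n)\<in>B.
               n = card {X. X \<subseteq> tuples (univ \<A>) (length zs) \<and>
                            models \<A> X (pi2_1var_sentence ys zs \<phi>)}))}"


section \<open>Counting satisfying assignments of monotone CNF formulas\<close>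

datatype literal = Pos nat | Negated nat

type_synonym cnf = "literal list list"

primrec lit_var :: "literal \<Rightarrow> nat" where
  "lit_var (Pos x) = x"
| "lit_var (Negated x) = x"

primrec lit_true :: "(nat \<Rightarrow> bool) \<Rightarrow> literal \<Rightarrow> bool" where
  "lit_true \<alpha> (Pos x) \<longleftrightarrow> \<alpha> x"
| "lit_true \<alpha> (Negated x) \<longleftrightarrow> \<not> \<alpha> x"

definition clause_vars :: "literal list \<Rightarrow> nat set" where
  "clause_vars c = lit_var ` set c"

definition cnf_vars :: "cnf \<Rightarrow> nat set" where
  "cnf_vars F = (\<Union>c\<in>set F. clause_vars c)"

definition monotone_cnf :: "cnf \<Rightarrow> bool" where
  "monotone_cnf F \<longleftrightarrow> (\<forall>c\<in>set F. \<forall>l\<in>set c. \<exists>x. l = Pos x)"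

definition num_sat :: "cnf \<Rightarrow> nat" where
  "num_sat F =
     card {\<alpha> \<in> cnf_vars F \<rightarrow>\<^sub>E (UNIV :: bool set). \<forall>c\<in>set F. \<exists>l\<in>set c. lit_true \<alpha> l}"

datatype msat_symbol = C

primrec msat_arity :: "msat_symbol \<Rightarrow> nat" where
  "msat_arity C = 2"

text \<open>
  The universe consists of the clauses (positions in the list) together with the variables
  of the formula, without overlap; \<open>e\<close> names the elements. The order is not constrained.
\<close>

definition encodes :: "msat_symbol fostruct \<Rightarrow> cnf \<Rightarrow> bool" where
  "encodes \<A> F \<longleftrightarrow>
     (\<exists>e :: nat + nat \<Rightarrow> nat.
        bij_betw e ({..<length F} <+> cnf_vars F) (univ \<A>) \<and>
        interp \<A> C =
          {[e (Inl i), e (Inr x)] |i x. i < length F \<and> x \<in> clause_vars (F ! i)})"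

definition sharp_MonotoneSat :: "msat_symbol counting_problem" where
  "sharp_MonotoneSat =
     {(\<A>, num_sat F) |\<A> F. ordered_structure msat_arity \<A> \<and> monotone_cnf F \<and> encodes \<A> F}"

text \<open>Every CNF formula has an encoding, so no instance is lost.\<close>

lemma ex_encoding: "\<exists>\<A>. ordered_structure msat_arity \<A> \<and> encodes \<A> F"
proof -
  define D where "D = {..<length F} <+> cnf_vars F"
  have fin: "finite D"
    by (auto simp: D_def cnf_vars_def clause_vars_def)
  then obtain e where e: "bij_betw e D {0..<card D}"
    using ex_bij_betw_finite_nat by blast
  define \<A> :: "msat_symbol fostruct" where
    "\<A> = \<lparr>univ = {0..<card D}, ord = {(a, b). a \<le> b \<and> b < card D},
          interp = (\<lambda>_. {[e (Inl i), e (Inr x)] |i x. i < length F \<and> x \<in> clause_vars (F ! i)})\<rparr>"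
  have "e d \<in> {0..<card D}" if "d \<in> D" for d
    using e that by (auto simp: bij_betw_def)
  moreover have "Inl i \<in> D \<and> Inr x \<in> D" if "i < length F" "x \<in> clause_vars (F ! i)" for i x
    using that by (auto simp: D_def cnf_vars_def intro: nth_mem)
  ultimately have "interp \<A> r \<subseteq> tuples (univ \<A>) (msat_arity r)" for r
    by (cases r) (fastforce simp: \<A>_def tuples_def)
  moreover have "linear_order_on (univ \<A>) (ord \<A>)"
    by (auto simp: \<A>_def linear_order_on_def partial_order_on_def preorder_on_def
        refl_on_def total_on_def intro!: transI antisymI)
  moreover have "encodes \<A> F"
    using e unfolding encodes_def D_def[symmetric] by (auto simp: \<A>_def)
  moreover have "finite (univ \<A>)"
    by (simp add: \<A>_def)
  ultimately show ?thesis
    unfolding ordered_structure_def by blast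
qed

end

theory Submission imports Defs begin

text \<open>
  Take \<open>X\<close> to be the set of true variables together with all clauses; adding the clauses makes
  \<open>X\<close> unique for each assignment. Two conditions have to be imposed by the single matrix
  \<open>\<phi>(y\<^sub>1, y\<^sub>2, z) \<and> X(z)\<close>: every clause has a variable in \<open>X\<close>, and every clause belongs to \<open>X\<close>.
  The universal pair selects which one is tested at \<open>y\<^sub>1\<close>: the first if \<open>y\<^sub>1 = y\<^sub>2\<close>, the second
  otherwise. When \<open>y\<^sub>1\<close> is a variable \<open>\<phi>\<close> imposes nothing on \<open>z\<close>; what remains is \<open>X \<noteq> \<emptyset>\<close>, and
  this follows from the first condition since a variable occurs in some clause. The second
  condition is missing only for universes with one element, which encode a single empty clause.
\<close>

text \<open>Every variable in \<open>cnf_vars\<close> lies in some clause, so the variables are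
  exactly the second components of \<open>C\<close>. The bound index \<open>w\<close> has to differ
  from \<open>y\<close>.\<close>

definition is_var :: "nat \<Rightarrow> nat \<Rightarrow> msat_symbol fm" where
  "is_var w y = Ex w (Rel C [w, y])"

text \<open>Indices 0 and 1 are the universal pair, 2 is the existential witness, 3 is
  bound.\<close>

definition msat_matrix :: "msat_symbol fm" where
  "msat_matrix =
     Disj (is_var 3 0)
       (Disj (Conj (Eq 0 1) (Rel C [0, 2])) (Conj (Neg (Eq 0 1)) (Eq 2 0)))"

lemma models_msat_iff:
  "models \<A> X (pi2_1var_sentence [0, 1] [2] msat_matrix) \<longleftrightarrow>
   (\<forall>a\<in>univ \<A>. \<forall>b\<in>univ \<A>. \<exists>z\<in>univ \<A>. [z] \<in> X \<and>
      ((\<exists>c\<in>univ \<A>. [c, a] \<in> interp \<A> C) \<or> a = b \<and> [a, z] \<in> interp \<A> C \<or> a \<noteq> b \<and> z = a))"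
  by (simp add: models_def pi2_1var_sentence_def msat_matrix_def is_var_def conj_commute)

lemma monotone_clause_sat_iff:
  assumes "monotone_cnf F" "c \<in> set F"
  shows "(\<exists>l\<in>set c. lit_true \<alpha> l) \<longleftrightarrow> (\<exists>x\<in>clause_vars c. \<alpha> x)"
proof -
  have "lit_true \<alpha> l \<longleftrightarrow> \<alpha> (lit_var l)" if "l \<in> set c" for l
    using assms that by (force simp: monotone_cnf_def)
  then show ?thesis
    by (simp add: clause_vars_def)
qed

lemma monotone_cnf_sat_iff:
  assumes "monotone_cnf F"
  shows "(\<forall>c\<in>set F. \<exists>l\<in>set c. lit_true \<alpha> l) \<longleftrightarrow>
    (\<forall>i<length F. \<exists>x\<in>clause_vars (F ! i). \<alpha> x)"
  by (simp add: all_set_conv_all_nth monotone_clause_sat_iff[OF assms])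

text \<open>Fixes one of the namings whose existence \<open>encodes\<close> asserts, so that clauses
  and variables can be addressed through \<open>e\<close>.\<close>

locale encoded_cnf =
  fixes \<A> :: "msat_symbol fostruct" and F :: cnf and e :: "nat + nat \<Rightarrow> nat"
  assumes bij: "bij_betw e ({..<length F} <+> cnf_vars F) (univ \<A>)"
    and interp_C: "interp \<A> C =
      {[e (Inl i), e (Inr x)] |i x. i < length F \<and> x \<in> clause_vars (F ! i)}"
begin

lemma univ_eq: "univ \<A> = (\<lambda>i. e (Inl i)) ` {..<length F} \<union> (\<lambda>x. e (Inr x)) ` cnf_vars F"
  using bij by (auto simp: bij_betw_def)

lemma inj: "inj_on e ({..<length F} <+> cnf_vars F)"
  using bij by (simp add: bij_betw_def)

lemma Inl_eq_iff [simp]: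
  "i < length F \<Longrightarrow> j < length F \<Longrightarrow> e (Inl i) = e (Inl j) \<longleftrightarrow> i = j"
  using inj_on_eq_iff[OF inj, of "Inl i" "Inl j"] by auto

lemma Inr_eq_iff [simp]:
  "x \<in> cnf_vars F \<Longrightarrow> y \<in> cnf_vars F \<Longrightarrow> e (Inr x) = e (Inr y) \<longleftrightarrow> x = y"
  using inj_on_eq_iff[OF inj, of "Inr x" "Inr y"] by auto

lemma Inl_neq_Inr [simp]:
  assumes "i < length F" "x \<in> cnf_vars F"
  shows "e (Inl i) \<noteq> e (Inr x)" "e (Inr x) \<noteq> e (Inl i)"
proof -
  show "e (Inl i) \<noteq> e (Inr x)"
    using inj_on_eq_iff[OF inj, of "Inl i" "Inr x"] assms by auto
  then show "e (Inr x) \<noteq> e (Inl i)"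
    by (rule not_sym)
qed

lemma clause_vars_nth: "i < length F \<Longrightarrow> x \<in> clause_vars (F ! i) \<Longrightarrow> x \<in> cnf_vars F"
  by (auto simp: cnf_vars_def)

lemma cnf_varsE:
  assumes "x \<in> cnf_vars F"
  obtains i where "i < length F" "x \<in> clause_vars (F ! i)"
  using assms by (auto simp: cnf_vars_def in_set_conv_nth)

lemma interp_clause_iff:
  "i < length F \<Longrightarrow>
   [e (Inl i), z] \<in> interp \<A> C \<longleftrightarrow> (\<exists>x\<in>clause_vars (F ! i). z = e (Inr x))"
  by (auto simp: interp_C)

text \<open>Second components of \<open>C\<close> are variables, whose names differ from those of
  clauses. Hence \<open>is_var\<close> fails at a clause and only the two tests remain
  there.\<close>

lemma not_interp_clause: "i < length F \<Longrightarrow> [c, e (Inl i)] \<notin> interp \<A> C"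
  by (auto simp: interp_C dest: clause_vars_nth)

lemma models_iff_clauses:
  "models \<A> X (pi2_1var_sentence [0, 1] [2] msat_matrix) \<longleftrightarrow>
   (\<forall>i<length F. [e (Inl i)] \<in> X \<and> (\<exists>x\<in>clause_vars (F ! i). [e (Inr x)] \<in> X))"
  (is "?M \<longleftrightarrow> ?R")
proof
  assume M: ?M
  show ?R
  proof (intro allI impI)
    fix i assume i: "i < length F"
    then have iU: "e (Inl i) \<in> univ \<A>"
      by (auto simp: univ_eq)
    have test: "\<exists>z\<in>univ \<A>. [z] \<in> X \<and>
        (e (Inl i) = b \<and> [e (Inl i), z] \<in> interp \<A> C \<or> e (Inl i) \<noteq> b \<and> z = e (Inl i))"
      if "b \<in> univ \<A>" for b
      using M iU that not_interp_clause[OF i] unfolding models_msat_iff by blast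
    \<comment> \<open>Choosing the clause itself for \<open>b\<close> selects the first
      test.\<close>
    obtain x where x: "x \<in> clause_vars (F ! i)" "[e (Inr x)] \<in> X"
      using test[OF iU] i by (auto simp: interp_clause_iff)
    \<comment> \<open>The variable just found is an element other than the clause; choosing it for
      \<open>b\<close> selects the second test.\<close>
    have "e (Inr x) \<in> univ \<A>" "e (Inl i) \<noteq> e (Inr x)"
      using x(1) i clause_vars_nth by (auto simp: univ_eq)
    then have "[e (Inl i)] \<in> X"
      using test by blast
    with x show "[e (Inl i)] \<in> X \<and> (\<exists>x\<in>clause_vars (F ! i). [e (Inr x)] \<in> X)"
      by blast
  qed
next
  assume R: ?R
  show ?M
    unfolding models_msat_iff
  proof (intro ballI)
    fix a b assume a: "a \<in> univ \<A>" and "b \<in> univ \<A>"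
    from a consider (clause) i where "i < length F" "a = e (Inl i)"
      | (var) x where "x \<in> cnf_vars F" "a = e (Inr x)"
      by (auto simp: univ_eq)
    then show "\<exists>z\<in>univ \<A>. [z] \<in> X \<and>
      ((\<exists>c\<in>univ \<A>. [c, a] \<in> interp \<A> C) \<or> a = b \<and> [a, z] \<in> interp \<A> C \<or> a \<noteq> b \<and> z = a)"
    proof cases
      case clause
      with R obtain x where x: "x \<in> clause_vars (F ! i)" "[e (Inr x)] \<in> X" "[a] \<in> X"
        by blast
      then have "e (Inr x) \<in> univ \<A>" "[a, e (Inr x)] \<in> interp \<A> C"
        using clause clause_vars_nth by (auto simp: univ_eq interp_clause_iff)
      \<comment> \<open>The witness is \<open>e (Inr x)\<close> if \<open>a = b\<close>, and
        \<open>a\<close> itself otherwise.\<close>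
      with x a show ?thesis
        by blast
    next
      case var
      \<comment> \<open>A clause containing the variable serves twice: as the \<open>c\<close> in
        \<open>is_var\<close>, and as the witness \<open>z\<close>, since \<open>X\<close> contains
        all clauses.\<close>
      then obtain i where i: "i < length F" "x \<in> clause_vars (F ! i)"
        by (blast elim: cnf_varsE)
      then have "[e (Inl i)] \<in> X" "e (Inl i) \<in> univ \<A>" "[e (Inl i), a] \<in> interp \<A> C"
        using R var by (auto simp: univ_eq interp_clause_iff)
      then show ?thesis
        by blast
    qed
  qed
qed

definition set_of_assignment :: "(nat \<Rightarrow> bool) \<Rightarrow> nat list set" where
  "set_of_assignment \<alpha> =
     {[e (Inl i)] |i. i < length F} \<union> {[e (Inr x)] |x. x \<in> cnf_vars F \<and> \<alpha> x}"

text \<open>\<open>restrict\<close> gives the value \<open>undefined\<close> off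
  \<open>cnf_vars F\<close>, as the extensional function space in \<open>num_sat\<close>
  demands.\<close>

definition assignment_of_set :: "nat list set \<Rightarrow> nat \<Rightarrow> bool" where
  "assignment_of_set X = restrict (\<lambda>x. [e (Inr x)] \<in> X) (cnf_vars F)"

lemma clause_in_set_of_assignment: "i < length F \<Longrightarrow> [e (Inl i)] \<in> set_of_assignment \<alpha>"
  by (auto simp: set_of_assignment_def)

lemma var_in_set_of_assignment_iff:
  "x \<in> cnf_vars F \<Longrightarrow> [e (Inr x)] \<in> set_of_assignment \<alpha> \<longleftrightarrow> \<alpha> x"
  by (auto simp: set_of_assignment_def)

lemma num_sat_eq_card_models:
  assumes mono: "monotone_cnf F"
  shows "num_sat F = card {X. X \<subseteq> tuples (univ \<A>) 1 \<and>
    models \<A> X (pi2_1var_sentence [0, 1] [2] msat_matrix)}"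
proof -
  define S where "S =
    {\<alpha> \<in> cnf_vars F \<rightarrow>\<^sub>E (UNIV :: bool set). \<forall>i<length F. \<exists>x\<in>clause_vars (F ! i). \<alpha> x}"
  define T where "T = {X. X \<subseteq> tuples (univ \<A>) 1 \<and>
    (\<forall>i<length F. [e (Inl i)] \<in> X \<and> (\<exists>x\<in>clause_vars (F ! i). [e (Inr x)] \<in> X))}"
  have "bij_betw set_of_assignment S T"
  proof (rule bij_betwI)
    show "set_of_assignment \<in> S \<rightarrow> T"
    proof
      fix \<alpha> assume "\<alpha> \<in> S"
      then have "\<forall>i<length F. \<exists>x\<in>clause_vars (F ! i). [e (Inr x)] \<in> set_of_assignment \<alpha>"
        by (auto simp: S_def var_in_set_of_assignment_iff clause_vars_nth)
      moreover have "set_of_assignment \<alpha> \<subseteq> tuples (univ \<A>) 1"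
        by (auto simp: set_of_assignment_def tuples_def univ_eq)
      ultimately show "set_of_assignment \<alpha> \<in> T"
        by (simp add: T_def clause_in_set_of_assignment)
    qed
    show "assignment_of_set \<in> T \<rightarrow> S"
      by (auto simp: T_def S_def assignment_of_set_def clause_vars_nth)
    show "assignment_of_set (set_of_assignment \<alpha>) = \<alpha>" if "\<alpha> \<in> S" for \<alpha>
    proof (rule PiE_ext)
      show "\<alpha> \<in> cnf_vars F \<rightarrow>\<^sub>E UNIV"
        using that by (simp add: S_def)
      show "assignment_of_set (set_of_assignment \<alpha>) \<in> cnf_vars F \<rightarrow>\<^sub>E UNIV"
        by (simp add: assignment_of_set_def)
    qed (simp add: assignment_of_set_def var_in_set_of_assignment_iff)
    show "set_of_assignment (assignment_of_set X) = X" if "X \<in> T" for X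
    proof
      \<comment> \<open>This inclusion relies on \<open>X\<close> containing every clause.\<close>
      show "set_of_assignment (assignment_of_set X) \<subseteq> X"
        using that by (auto simp: T_def set_of_assignment_def assignment_of_set_def)
      show "X \<subseteq> set_of_assignment (assignment_of_set X)"
      proof
        \<comment> \<open>\<open>X\<close> is unary and the universe holds only clauses and
          variables, so nothing else can occur in it.\<close>
        fix as assume "as \<in> X"
        moreover from this that obtain a where "as = [a]" "a \<in> univ \<A>"
          by (fastforce simp: T_def tuples_def length_Suc_conv)
        ultimately show "as \<in> set_of_assignment (assignment_of_set X)"
          by (auto simp: univ_eq set_of_assignment_def assignment_of_set_def)
      qed
    qed
  qed
  then have "card S = card T"
    by (rule bij_betw_same_card)
  then show ?thesis
    unfolding num_sat_def monotone_cnf_sat_iff[OF mono] models_iff_clauses S_def T_def .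
qed

end

theorem theorem4: "sharp_MonotoneSat \<in> sharp_Pi2_1VAR msat_arity"
proof -
  have "n = card {X. X \<subseteq> tuples (univ \<A>) (length [2::nat]) \<and>
      models \<A> X (pi2_1var_sentence [0, 1] [2] msat_matrix)}"
    if "(\<A>, n) \<in> sharp_MonotoneSat" for \<A> n
  proof -
    from that obtain F where F: "n = num_sat F" "monotone_cnf F" "encodes \<A> F"
      by (auto simp: sharp_MonotoneSat_def)
    then obtain e where "encoded_cnf \<A> F e"
      by (auto simp: encodes_def encoded_cnf_def)
    from encoded_cnf.num_sat_eq_card_models[OF this F(2)] F(1) show ?thesis
      by simp
  qed
  moreover have "first_order msat_arity msat_matrix" "fv msat_matrix \<subseteq> set ([0, 1] @ [2])"
    by (auto simp: msat_matrix_def is_var_def)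
  moreover have "sharp_MonotoneSat \<subseteq> {\<A>. ordered_structure msat_arity \<A>} \<times> UNIV"
    by (auto simp: sharp_MonotoneSat_def)
  moreover have "distinct ([0, 1] @ [2::nat])" "[2::nat] \<noteq> []"
    by simp_all
  ultimately show ?thesis
    unfolding sharp_Pi2_1VAR_def by blast
qed

end
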